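(* Let $n \ge 4$ be an integer with $n \ne 6$, and let $\rho$ be an integer with $1 \le \rho \le n$. Then there exists a $(3n+1+\rho,4)$-packing with exactly $n\rho + D(\rho+1,4)$ blocks in which the largest partial parallel class has size $\rho$.
   Context: For integers $v \ge k \ge 2$, a $(v,k)$-packing is a pair $(X,\mathcal{B})$ where $X$ is a set of $v$ points and $\mathcal{B}$ is a set of $k$-subsets of $X$ (blocks) such that every pair of distinct points lies in at most one block. For integers $m \ge 0$, $D(m,k)$ denotes the maximum number of $k$-subsets of an $m$-set such that every pair of points lies in at most one of them (so $D(m,k)=0$ if $m<k$). A partial parallel class (PPC) is a set of pairwise disjoint blocks; its size is the number of blocks. "The largest PPC has size $\rho$" means the packing has a PPC of size $\rho$ but none of size $\rho+1$. *)

theory Defs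
  imports Main
begin

definition is_packing :: "'a set \<Rightarrow> 'a set set \<Rightarrow> nat \<Rightarrow> bool" where
  "is_packing X B k \<longleftrightarrow> finite X \<and>
     (\<forall>b\<in>B. b \<subseteq> X \<and> card b = k) \<and>
     (\<forall>x\<in>X. \<forall>y\<in>X. x \<noteq> y \<longrightarrow> card {b\<in>B. x \<in> b \<and> y \<in> b} \<le> 1)"

definition D :: "nat \<Rightarrow> nat \<Rightarrow> nat" where
  "D m k = Max {card B | B. is_packing {0..<m} B k}"

definition is_ppc :: "'a set set \<Rightarrow> 'a set set \<Rightarrow> bool" where
  "is_ppc B P \<longleftrightarrow> P \<subseteq> B \<and> (\<forall>b1\<in>P. \<forall>b2\<in>P. b1 \<noteq> b2 \<longrightarrow> b1 \<inter> b2 = {})"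

definition largest_ppc_size :: "'a set set \<Rightarrow> nat \<Rightarrow> bool" where
  "largest_ppc_size B r \<longleftrightarrow> (\<exists>P. is_ppc B P \<and> card P = r) \<and>
                              \<not> (\<exists>P. is_ppc B P \<and> card P = r + 1)"

end

theory Submission
  imports Defs "HOL-Number_Theory.Cong"
begin

text \<open>
  Suppose the \<open>3 n\<close> points \<open>X \<times> {0, 1, 2}\<close>, with \<open>X\<close> of size \<open>n\<close>, carry \<open>n\<close> parallel classes of triples,
  indexed by \<open>X\<close>, such that two points are joined at most once overall and the class of \<open>x\<close> contains
  the fibre \<open>{x} \<times> {0, 1, 2}\<close>. Adding a new point to all triples of each of \<open>\<rho>\<close> classes gives \<open>n \<rho>\<close>
  blocks; a maximum packing on the \<open>\<rho>\<close> new points and one further point gives \<open>D (\<rho> + 1) 4\<close> more.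
  Every block contains one of the \<open>\<rho>\<close> new points, so no PPC has more than \<open>\<rho>\<close> blocks, and the
  extended fibres form one of size \<open>\<rho>\<close>.

  Unlike a transversal design, such a system may use triples with two points on the same level, which
  makes room for cyclic constructions of even order: one class and its translates modulo \<open>n\<close>. Such
  starters are listed for small \<open>n\<close>, and for \<open>n\<close> coprime to 6 there is a linear one. The property is
  closed under pairwise balanced designs because the fibres can be shared by all blocks, and
  truncated transversal designs of block size 4 and 5 on \<open>4 m + u\<close> points, with \<open>m\<close> coprime to 6,
  cover all remaining \<open>n \<ge> 4\<close>.
\<close>

section \<open>Rainbow parallel classes\<close>

definition fibre :: "'a \<Rightarrow> ('a \<times> int) set" where
  "fibre x = {x} \<times> {0..<3}"

text \<open>The name refers to the fibres: together they form a parallel class that takes one triple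
  from each of the classes \<open>C x\<close>. The last clause only asks for x = y, because two
  triples of one class that meet are equal by the partition clause; \<open>rainbow_pair\<close>
  draws the full conclusion.\<close>

definition rainbow_classes :: "'a set \<Rightarrow> ('a \<Rightarrow> ('a \<times> int) set set) \<Rightarrow> bool" where
  "rainbow_classes X C \<longleftrightarrow>
     (\<forall>x\<in>X. fibre x \<in> C x \<and> (\<forall>A\<in>C x. A \<subseteq> X \<times> {0..<3} \<and> card A = 3)) \<and>
     (\<forall>x\<in>X. \<forall>p\<in>X \<times> {0..<3}. \<exists>!A. A \<in> C x \<and> p \<in> A) \<and>
     (\<forall>x\<in>X. \<forall>y\<in>X. \<forall>A\<in>C x. \<forall>B\<in>C y. \<forall>p\<in>A \<inter> B. \<forall>q\<in>A \<inter> B. p \<noteq> q \<longrightarrow> x = y)"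

definition rainbow :: "'a set \<Rightarrow> bool" where
  "rainbow X \<longleftrightarrow> (\<exists>C. rainbow_classes X C)"

lemma fibre_iff: "p \<in> fibre x \<longleftrightarrow> fst p = x \<and> snd p \<in> {0..<3}"
  by (cases p) (auto simp: fibre_def)

lemma card_fibre: "card (fibre x) = 3"
  by (simp add: fibre_def)

lemma rainbow_classesI:
  assumes "\<And>x. x \<in> X \<Longrightarrow> fibre x \<in> C x"
    and "\<And>x A. x \<in> X \<Longrightarrow> A \<in> C x \<Longrightarrow> A \<subseteq> X \<times> {0..<3}"
    and "\<And>x A. x \<in> X \<Longrightarrow> A \<in> C x \<Longrightarrow> card A = 3"
    and "\<And>x p. x \<in> X \<Longrightarrow> p \<in> X \<times> {0..<3} \<Longrightarrow> \<exists>A\<in>C x. p \<in> A"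
    and "\<And>x A B p. x \<in> X \<Longrightarrow> A \<in> C x \<Longrightarrow> B \<in> C x \<Longrightarrow> p \<in> A \<Longrightarrow> p \<in> B \<Longrightarrow> A = B"
    and "\<And>x y A B p q. x \<in> X \<Longrightarrow> y \<in> X \<Longrightarrow> A \<in> C x \<Longrightarrow> B \<in> C y \<Longrightarrow>
           p \<in> A \<Longrightarrow> p \<in> B \<Longrightarrow> q \<in> A \<Longrightarrow> q \<in> B \<Longrightarrow> p \<noteq> q \<Longrightarrow> x = y"
  shows "rainbow_classes X C"
  unfolding rainbow_classes_def
proof (intro conjI ballI impI)
  fix x and p :: "'a \<times> int" assume xp: "x \<in> X" "p \<in> X \<times> {0..<3}"
  show "\<exists>!A. A \<in> C x \<and> p \<in> A"
    using assms(4)[OF xp] assms(5)[OF xp(1)] by metis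
qed (use assms(1-3,6) in \<open>simp_all, fast+\<close>)

context
  fixes X :: "'a set" and C
  assumes C: "rainbow_classes X C"
begin

lemma rainbow_fibre: "x \<in> X \<Longrightarrow> fibre x \<in> C x"
  and rainbow_subset: "x \<in> X \<Longrightarrow> A \<in> C x \<Longrightarrow> A \<subseteq> X \<times> {0..<3}"
  and rainbow_card: "x \<in> X \<Longrightarrow> A \<in> C x \<Longrightarrow> card A = 3"
  using C by (simp_all add: rainbow_classes_def)

lemma rainbow_unique:
  assumes "x \<in> X" "p \<in> X \<times> {0..<3}"
  shows "\<exists>!A. A \<in> C x \<and> p \<in> A"
proof -
  have "\<forall>x\<in>X. \<forall>p\<in>X \<times> {0..<3}. \<exists>!A. A \<in> C x \<and> p \<in> A"
    using C unfolding rainbow_classes_def by (elim conjE)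
  then show ?thesis
    using assms by (elim ballE) auto
qed

lemma rainbow_cover:
  assumes "x \<in> X" "p \<in> X \<times> {0..<3}"
  shows "\<exists>A\<in>C x. p \<in> A"
  using rainbow_unique[OF assms] by (elim ex1E) blast

lemma rainbow_disjoint:
  assumes "x \<in> X" "A \<in> C x" "B \<in> C x" "p \<in> A" "p \<in> B"
  shows "A = B"
proof -
  have "p \<in> X \<times> {0..<3}"
    using rainbow_subset[OF assms(1,2)] assms(4) by (rule subsetD)
  then show ?thesis
    using rainbow_unique[OF assms(1)] assms(2-5) by (metis (no_types))
qed

lemma rainbow_pair:
  assumes "x \<in> X" "y \<in> X" "A \<in> C x" "B \<in> C y" "p \<in> A" "p \<in> B" "q \<in> A" "q \<in> B" "p \<noteq> q"
  shows "x = y" "A = B"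
proof -
  have "\<forall>x\<in>X. \<forall>y\<in>X. \<forall>A\<in>C x. \<forall>B\<in>C y. \<forall>p\<in>A \<inter> B. \<forall>q\<in>A \<inter> B. p \<noteq> q \<longrightarrow> x = y"
    using C unfolding rainbow_classes_def by (elim conjE)
  then show "x = y"
    using assms by (metis (no_types) IntI)
  then show "A = B"
    using assms rainbow_disjoint by metis
qed

end

section \<open>Transport along injections, and closure under pairwise balanced designs\<close>

lemma rainbow_image:
  assumes "rainbow X" and inj: "inj_on f X"
  shows "rainbow (f ` X)"
proof -
  from assms(1) obtain C where C: "rainbow_classes X C"
    unfolding rainbow_def by blast
  define g where "g = map_prod f (id :: int \<Rightarrow> int)"
  have g: "inj_on g (X \<times> {0..<3})"
    unfolding g_def by (auto simp: inj_on_def dest: inj_onD[OF inj])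
  have g_img: "g ` (X \<times> {0..<3}) = f ` X \<times> {0..<3}"
    unfolding g_def by (simp add: map_prod_surj_on)
  define C' where "C' y = (`) g ` C (inv_into X f y)" for y
  have C': "C' (f x) = (`) g ` C x" if "x \<in> X" for x
    using that inj by (simp add: C'_def)
  have eq: "g p = g q \<Longrightarrow> p = q" if "x \<in> X" "y \<in> X" "A \<in> C x" "B \<in> C y" "p \<in> A" "q \<in> B" for x y A B p q
    using that rainbow_subset[OF C] inj_onD[OF g] by (meson subsetD)
  have "rainbow_classes (f ` X) C'"
  proof (rule rainbow_classesI)
    fix y assume "y \<in> f ` X"
    then obtain x where x: "x \<in> X" "y = f x" by blast
    have C'y: "C' y = (`) g ` C x" using x C' by simp
    have "fibre y = g ` fibre x"
      unfolding fibre_def g_def x by force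
    then show "fibre y \<in> C' y"
      using rainbow_fibre[OF C x(1)] by (simp add: C'y)
    show "A \<subseteq> f ` X \<times> {0..<3}" if "A \<in> C' y" for A
      using that rainbow_subset[OF C x(1)] unfolding C'y by (auto simp flip: g_img)
    show "card A = 3" if A: "A \<in> C' y" for A
    proof -
      obtain A0 where A0: "A0 \<in> C x" "A = g ` A0"
        using A unfolding C'y by blast
      have "inj_on g A0"
        using inj_on_subset[OF g] rainbow_subset[OF C x(1) A0(1)] .
      then show ?thesis
        using rainbow_card[OF C x(1) A0(1)] A0 by (simp add: card_image)
    qed
    show "\<exists>A\<in>C' y. p \<in> A" if p: "p \<in> f ` X \<times> {0..<3}" for p
    proof -
      obtain q where q: "q \<in> X \<times> {0..<3}" "p = g q"
        using p unfolding g_img[symmetric] by blast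
      obtain A where "A \<in> C x" "q \<in> A"
        using rainbow_cover[OF C x(1) q(1)] by blast
      then show ?thesis
        unfolding C'y q(2) by blast
    qed
    show "A = B" if AB: "A \<in> C' y" "B \<in> C' y" "p \<in> A" "p \<in> B" for A B p
    proof -
      obtain A0 B0 where A0: "A0 \<in> C x" "A = g ` A0" and B0: "B0 \<in> C x" "B = g ` B0"
        using AB(1,2) unfolding C'y by blast
      obtain q r where "q \<in> A0" "p = g q" "r \<in> B0" "p = g r"
        using AB(3,4) unfolding A0(2) B0(2) by blast
      moreover from this have "q = r"
        using eq[OF x(1) x(1) A0(1) B0(1)] by simp
      ultimately show ?thesis
        using rainbow_disjoint[OF C x(1) A0(1) B0(1)] A0(2) B0(2) by blast
    qed
    fix z A B p q
    assume "z \<in> f ` X" and AB: "A \<in> C' y" "B \<in> C' z" "p \<in> A" "p \<in> B" "q \<in> A" "q \<in> B" "p \<noteq> q"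
    then obtain w where w: "w \<in> X" "z = f w" by blast
    have C'z: "C' z = (`) g ` C w" using w C' by simp
    obtain A0 B0 where A0: "A0 \<in> C x" "A = g ` A0" and B0: "B0 \<in> C w" "B = g ` B0"
      using AB(1,2) unfolding C'y C'z by blast
    obtain p0 q0 where p0: "p0 \<in> A0" "p0 \<in> B0" "g p0 = p" and q0: "q0 \<in> A0" "q0 \<in> B0" "g q0 = q"
      using AB(3-6) eq[OF x(1) w(1) A0(1) B0(1)] unfolding A0(2) B0(2) by (metis imageE)
    have "x = w"
      using rainbow_pair(1)[OF C x(1) w(1) A0(1) B0(1), of p0 q0] p0 q0 \<open>p \<noteq> q\<close> by blast
    then show "y = z"
      using x w by simp
  qed
  then show ?thesis
    unfolding rainbow_def by blast
qed

text \<open>Lets the groups and lines of a design, and integer or natural intervals, stand in for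
  each other in the recursion.\<close>

lemma rainbow_card_cong:
  assumes "rainbow X" "finite X" "finite Y" "card X = card Y"
  shows "rainbow Y"
proof -
  obtain f where "bij_betw f X Y"
    using assms finite_same_card_bij by blast
  then show ?thesis
    using rainbow_image[OF assms(1), of f] by (auto simp: bij_betw_def)
qed

text \<open>The design blocks through x partition the remaining points of X, so their classes at x,
  with the common fibre taken once, combine to a single class over X. Two points in different fibres
  lie over a unique design block, which reduces the pair condition to that block; two points of one
  fibre are joined by that fibre only.\<close>

lemma rainbow_pbd:
  assumes bl: "\<And>B. B \<in> \<B> \<Longrightarrow> B \<subseteq> X" "\<And>B. B \<in> \<B> \<Longrightarrow> rainbow B"
    and ex: "\<And>x y. x \<in> X \<Longrightarrow> y \<in> X \<Longrightarrow> x \<noteq> y \<Longrightarrow> \<exists>B\<in>\<B>. x \<in> B \<and> y \<in> B"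
    and un: "\<And>x y B B'. x \<noteq> y \<Longrightarrow> B \<in> \<B> \<Longrightarrow> B' \<in> \<B> \<Longrightarrow> x \<in> B \<Longrightarrow> y \<in> B \<Longrightarrow> x \<in> B' \<Longrightarrow> y \<in> B' \<Longrightarrow> B = B'"
  shows "rainbow X"
proof -
  obtain C where C: "\<And>B. B \<in> \<B> \<Longrightarrow> rainbow_classes B (C B)"
    using bl(2) unfolding rainbow_def by metis
  define E where "E x = insert (fibre x) (\<Union>B\<in>{B\<in>\<B>. x \<in> B}. C B x - {fibre x})" for x
  have E_cases: "A = fibre x \<or> (\<exists>B\<in>\<B>. x \<in> B \<and> A \<in> C B x \<and> A \<noteq> fibre x)" if "A \<in> E x" for A x
    using that unfolding E_def by blast
  \<comment> \<open>\<open>C B x\<close> is a partition with \<open>fibre x\<close> as one part, so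
    its other triples miss that fibre.\<close>
  have away: "fst p \<noteq> x" "fst p \<in> B" "snd p \<in> {0..<3}"
    if "B \<in> \<B>" "x \<in> B" "A \<in> C B x" "A \<noteq> fibre x" "p \<in> A" for B x A p
  proof -
    have p: "p \<in> B \<times> {0..<3}"
      using rainbow_subset[OF C[OF that(1)] that(2,3)] that(5) by blast
    then show "fst p \<in> B" "snd p \<in> {0..<3}" by auto
    show "fst p \<noteq> x"
    proof
      assume "fst p = x"
      then have "p \<in> fibre x" using p by (auto simp: fibre_iff)
      then show False
        using rainbow_disjoint[OF C[OF that(1)] that(2,3)] rainbow_fibre[OF C[OF that(1)] that(2)] that by blast
    qed
  qed
  \<comment> \<open>Otherwise the triple shares two points with the fibre over \<open>fst p\<close>,
    which belongs to the class of \<open>fst p\<close>. Then x = \<open>fst p\<close>, against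
    \<open>away\<close>.\<close>
  have transversal: "fst p \<noteq> fst q"
    if "B \<in> \<B>" "x \<in> B" "A \<in> C B x" "A \<noteq> fibre x" "p \<in> A" "q \<in> A" "p \<noteq> q" for B x A p q
  proof
    assume eq: "fst p = fst q"
    have pq: "fst p \<in> B" "p \<in> fibre (fst p)" "q \<in> fibre (fst p)"
      using away[OF that(1-4)] that(5,6) eq by (auto simp: fibre_iff)
    then have "x = fst p"
      using rainbow_pair(1)[OF C[OF that(1)] that(2) pq(1) that(3) rainbow_fibre[OF C[OF that(1)] pq(1)]] that by blast
    then show False
      using away(1)[OF that(1-5)] by simp
  qed
  have "rainbow_classes X E"
  proof (rule rainbow_classesI)
    fix x assume x: "x \<in> X"
    show "fibre x \<in> E x" by (simp add: E_def)
    show "A \<subseteq> X \<times> {0..<3}" if "A \<in> E x" for A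
      using E_cases[OF that]
    proof (elim disjE bexE conjE)
      show ?thesis if "A = fibre x" using that x by (auto simp: fibre_iff)
      show ?thesis if "B \<in> \<B>" "x \<in> B" "A \<in> C B x" for B
        using rainbow_subset[OF C[OF that(1)] that(2,3)] bl(1)[OF that(1)] by blast
    qed
    show "card A = 3" if "A \<in> E x" for A
      using E_cases[OF that] rainbow_card[OF C] card_fibre by metis
    show "\<exists>A\<in>E x. p \<in> A" if p: "p \<in> X \<times> {0..<3}" for p
    proof (cases "fst p = x")
      case True
      then show ?thesis using p by (intro bexI[of _ "fibre x"]) (auto simp: fibre_iff E_def)
    next
      case False
      then obtain B where B: "B \<in> \<B>" "x \<in> B" "fst p \<in> B"
        using ex[of "fst p" x] x p by auto
      then obtain A where A: "A \<in> C B x" "p \<in> A"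
        using rainbow_cover[OF C[OF B(1)] B(2), of p] p by (cases p) auto
      have "A \<noteq> fibre x"
        using A False by (auto simp: fibre_iff)
      then show ?thesis
        using A B unfolding E_def by blast
    qed
    show "A = A'" if A: "A \<in> E x" and A': "A' \<in> E x" and p: "p \<in> A" "p \<in> A'" for A A' p
      using E_cases[OF A]
    proof (elim disjE bexE conjE)
      assume "A = fibre x"
      then show ?thesis
        using E_cases[OF A'] away(1)[of _ x A' p] p by (auto simp: fibre_iff)
    next
      fix B assume B: "B \<in> \<B>" "x \<in> B" "A \<in> C B x" "A \<noteq> fibre x"
      have "fst p \<noteq> x"
        using away(1)[OF B] p by blast
      then have "A' \<noteq> fibre x"
        using p by (auto simp: fibre_iff)
      then obtain B' where B': "B' \<in> \<B>" "x \<in> B'" "A' \<in> C B' x"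
        using E_cases[OF A'] by blast
      then have "B' = B"
        using un[OF \<open>fst p \<noteq> x\<close>] B away(2)[OF B] away(2)[OF B' \<open>A' \<noteq> fibre x\<close>] p by blast
      then show ?thesis
        using rainbow_disjoint[OF C[OF B(1)] B(2)] B B' p by blast
    qed
    fix y A A' p q
    assume y: "y \<in> X" and A: "A \<in> E x" and A': "A' \<in> E y"
      and pq: "p \<in> A" "p \<in> A'" "q \<in> A" "q \<in> A'" "p \<noteq> q"
    \<comment> \<open>Any two points of a triple thus reveal whether it is the fibre of its
      class.\<close>
    have fib: "A = fibre x \<longleftrightarrow> fst p = fst q" if "A \<in> E x" "p \<in> A" "q \<in> A" "p \<noteq> q" for A x
      using E_cases[OF that(1)] transversal[of _ x A p q] that by (auto simp: fibre_iff)
    show "x = y"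
    proof (cases "fst p = fst q")
      case True
      then show ?thesis
        using fib[OF A] fib[OF A'] pq by (metis fibre_iff)
    next
      case False
      then obtain B B' where B: "B \<in> \<B>" "x \<in> B" "A \<in> C B x" "A \<noteq> fibre x"
        and B': "B' \<in> \<B>" "y \<in> B'" "A' \<in> C B' y" "A' \<noteq> fibre y"
        using E_cases[OF A] E_cases[OF A'] fib[OF A] fib[OF A'] pq by metis
      then have "B' = B"
        using un[OF False B'(1) B(1)] away(2)[OF B] away(2)[OF B'] pq by blast
      then show ?thesis
        using rainbow_pair(1)[OF C[OF B(1)] B(2) _ B(3), of y A' p q] B' pq by blast
    qed
  qed
  then show ?thesis
    unfolding rainbow_def by blast
qed

section \<open>Linear congruences modulo an integer coprime to 6, and truncated transversal
  designs\<close>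

lemma coprime_6_cancel:
  fixes n x y :: int
  assumes "coprime n 6" "1 \<le> c" "c \<le> 4" "[c * x = c * y] (mod n)"
  shows "[x = y] (mod n)"
proof -
  \<comment> \<open>The square of 6 serves because 4 divides 36 but not 6; the bound 4 is the
    largest difference of two columns among 0, ..., 4.\<close>
  have "coprime n (6 * 6)"
    using assms(1) by (simp only: coprime_mult_right_iff)
  moreover have "c dvd 6 * 6"
  proof -
    have "c = 1 \<or> c = 2 \<or> c = 3 \<or> c = 4" using assms(2,3) by linarith
    then show ?thesis by auto
  qed
  ultimately have "coprime c n"
    by (metis coprime_commute coprime_divisors dvd_refl)
  then show ?thesis
    using assms(4) by (simp add: cong_mult_lcancel)
qed

lemma coprime_6_cancel_diff:
  fixes n x y i j :: int
  assumes n: "coprime n 6" and ij: "i \<noteq> j" "\<bar>i - j\<bar> \<le> 4" and eq: "[(i - j) * x = (i - j) * y] (mod n)"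
  shows "[x = y] (mod n)"
proof (cases "j < i")
  case True
  then show ?thesis
    using coprime_6_cancel[OF n, of "i - j" x y] assms by auto
next
  case False
  have "[- ((i - j) * x) = - ((i - j) * y)] (mod n)"
    using eq by (simp add: cong_minus_minus_iff)
  then show ?thesis
    using coprime_6_cancel[OF n, of "j - i" x y] False assms(2,3) by (auto simp: algebra_simps)
qed

text \<open>Yields a line y = a + i b through two points in distinct columns i and j. Multiplication
  by i - j is injective, hence surjective, on the residues modulo n, which gives the slope b; the
  intercept is then z - j b.\<close>

lemma coprime_6_solve:
  fixes n :: int
  assumes n: "coprime n 6" "n > 0" and ij: "i \<noteq> j" "\<bar>i - j\<bar> \<le> 4" 
  obtains a b where "[a + i * b = y] (mod n)" "[a + j * b = z] (mod n)"
proof -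
  have "\<exists>b. [(i - j) * b = c] (mod n)" for c
  proof -
    have "inj_on (\<lambda>b. ((i - j) * b) mod n) {0..<n}"
    proof (rule inj_onI)
      fix b b' assume b: "b \<in> {0..<n}" "b' \<in> {0..<n}" "((i - j) * b) mod n = ((i - j) * b') mod n"
      then have "[(i - j) * b = (i - j) * b'] (mod n)"
        by (simp only: cong_def)
      then have "[b = b'] (mod n)"
        by (rule coprime_6_cancel_diff[OF n(1) ij])
      then show "b = b'"
        using b(1,2) by (simp add: cong_def)
    qed
    moreover have "(\<lambda>b. ((i - j) * b) mod n) ` {0..<n} \<subseteq> {0..<n}"
      using n by auto
    ultimately have "(\<lambda>b. ((i - j) * b) mod n) ` {0..<n} = {0..<n}"
      by (simp add: endo_inj_surj)
    then have "c mod n \<in> (\<lambda>b. ((i - j) * b) mod n) ` {0..<n}"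
      using n by simp
    then show ?thesis
      by (auto simp: cong_def)
  qed
  then obtain b where b: "[(i - j) * b = y - z] (mod n)" by blast
  show ?thesis
  proof (rule that)
    show "[(z - j * b) + j * b = z] (mod n)" by simp
    have "[(i - j) * b + z = y - z + z] (mod n)"
      by (intro cong_add b cong_refl)
    then show "[(z - j * b) + i * b = y] (mod n)" by (simp add: algebra_simps)
  qed
qed

text \<open>Two points of different groups determine slope and intercept modulo m, hence exactly one
  line; two points of one group lie on no line. Every line meets the four full groups and possibly
  the truncated one, so m, u, 4 and 5 are the only block sizes.\<close>

lemma rainbow_truncated_td:
  fixes m u :: nat
  assumes m: "coprime (int m) 6" "m > 0" "u \<le> m"
    and r: "rainbow {0..<m}" "u \<le> 1 \<or> rainbow {0..<u}" "rainbow {0..<4::nat}" "rainbow {0..<5::nat}"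
  shows "rainbow {0..<4 * m + u}"
proof -
  \<comment> \<open>Four groups of size \<open>m\<close>, a truncated fifth group of size \<open>u\<close>, and the lines \<open>y = a + i b\<close>.\<close>
  define G where "G i = {i} \<times> {0..<(if i = 4 then int u else int m)}" for i :: int
  define X where "X = (\<Union>i\<in>{0..<5}. G i)"
  define T where "T a b = {(i, y) \<in> X. y = (a + i * b) mod int m}" for a b
  \<comment> \<open>The truncated group is a block only if it contains a pair of points; for u at
    most 1 nothing has to be known about it.\<close>
  define \<B> where "\<B> = {B. (\<exists>i\<in>{0..<5}. B = G i \<and> (i = 4 \<longrightarrow> u > 1)) \<or> (\<exists>a b. B = T a b)}"
  have X_iff: "(i, y) \<in> X \<longleftrightarrow> 0 \<le> i \<and> i < 5 \<and> 0 \<le> y \<and> y < (if i = 4 then int u else int m)" for i y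
    unfolding X_def G_def by auto
  have X_m: "0 \<le> y \<and> y < int m \<and> 0 \<le> i \<and> i < 5" if "(i, y) \<in> X" for i y
    using that m unfolding X_iff by (auto split: if_splits)
  have finG: "finite (G i)" and cardG: "card (G i) = (if i = 4 then u else m)" for i
    unfolding G_def by auto
  have finT: "finite (T a b)" and cardT: "card (T a b) = 4 \<or> card (T a b) = 5" for a b
  proof -
    define f where "f i = (i, (a + i * b) mod int m)" for i
    define I where "I = {i \<in> {0..<5::int}. f i \<in> X}"
    have "T a b = f ` I"
      unfolding T_def f_def I_def by (auto simp: X_m)
    \<comment> \<open>\<open>I\<close> is the set of columns in which the line survives truncation:
      always the four full ones, and column 4 exactly if the residue there is below u.\<close>
    moreover have "{0..<4} \<subseteq> I" "I \<subseteq> {0..<5}"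
      unfolding I_def f_def using m by (auto simp: X_iff)
    moreover have "inj_on f I"
      by (auto simp: f_def inj_on_def)
    moreover have finI: "finite I"
      using finite_subset[OF \<open>I \<subseteq> _\<close>] by simp
    ultimately show "finite (T a b)" "card (T a b) = 4 \<or> card (T a b) = 5"
      using card_mono[OF finI \<open>_ \<subseteq> I\<close>] card_mono[OF _ \<open>I \<subseteq> _\<close>] by (auto simp: card_image)
  qed
  have "rainbow X"
  proof (rule rainbow_pbd[of \<B>])
    fix B assume B: "B \<in> \<B>"
    then show "B \<subseteq> X"
      unfolding \<B>_def X_def T_def by auto
    show "rainbow B"
      using B unfolding \<B>_def
    proof (elim CollectE disjE bexE exE conjE)
      fix i assume "B = G i" "i = 4 \<longrightarrow> u > 1"
      then show ?thesis
        using rainbow_card_cong[OF r(1), of B] rainbow_card_cong[of "{0..<u}" B] r(2) finG[of i] cardG[of i]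
        by (auto split: if_splits)
    next
      fix a b assume "B = T a b"
      then show ?thesis
        using rainbow_card_cong[OF r(3), of B] rainbow_card_cong[OF r(4), of B] finT[of a b] cardT[of a b] by auto
    qed
  next
    fix p q assume pq: "p \<in> X" "q \<in> X" "p \<noteq> q"
    obtain i y j z where ij: "p = (i, y)" "q = (j, z)" by fastforce
    show "\<exists>B\<in>\<B>. p \<in> B \<and> q \<in> B"
    proof (cases "i = j")
      case True
      have "p \<in> G i" "q \<in> G i" "i \<in> {0..<5}"
        using pq True unfolding ij X_def G_def by auto
      moreover have "i = 4 \<longrightarrow> u > 1"
        using pq True unfolding ij X_iff by auto
      ultimately show ?thesis
        unfolding \<B>_def by blast
    next
      case False
      have "\<bar>i - j\<bar> \<le> 4"
        using X_m[of i y] X_m[of j z] pq unfolding ij by auto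
      then obtain a b where "[a + i * b = y] (mod int m)" "[a + j * b = z] (mod int m)"
        using coprime_6_solve[OF m(1) _ False] m(2) by (metis of_nat_0_less_iff)
      then have "p \<in> T a b" "q \<in> T a b"
        using pq X_m unfolding ij T_def by (auto simp: cong_def)
      then show ?thesis
        unfolding \<B>_def by blast
    qed
  next
    fix p q :: "int \<times> int" and B B'
    assume pq: "p \<noteq> q" and B: "B \<in> \<B>" "B' \<in> \<B>" "p \<in> B" "q \<in> B" "p \<in> B'" "q \<in> B'"
    obtain i y j z where ij: "p = (i, y)" "q = (j, z)" by fastforce
    have inX: "p \<in> X" "q \<in> X"
      using B unfolding \<B>_def X_def T_def by auto
    have inG: "B = G i" if "B \<in> \<B>" "p \<in> B" "q \<in> B" "i = j" for B
      using that(1)[unfolded \<B>_def] that(2-4) pq unfolding ij by (auto simp: G_def T_def)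
    \<comment> \<open>A group lies in one column, so a block with points in two columns is a
      line.\<close>
    have inT: "\<exists>a b. B = T a b \<and> [a + i * b = y] (mod int m) \<and> [a + j * b = z] (mod int m)"
      if "B \<in> \<B>" "p \<in> B" "q \<in> B" "i \<noteq> j" for B
    proof -
      have "\<exists>a b. B = T a b"
        using that(1)[unfolded \<B>_def] that(2-4) unfolding ij by (auto simp: G_def)
      then obtain a b where B: "B = T a b" by blast
      then have "y = (a + i * b) mod int m" "z = (a + j * b) mod int m"
        using that(2,3) unfolding ij by (auto simp: T_def)
      then show ?thesis
        using B by (auto simp: cong_def)
    qed
    show "B = B'"
    proof (cases "i = j")
      case True
      then show ?thesis using inG B by metis
    next
      case False
      have le: "\<bar>i - j\<bar> \<le> 4"
        using X_m[of i y] X_m[of j z] inX unfolding ij by auto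
      obtain a b a' b' where T: "B = T a b" "B' = T a' b'"
        and ab: "[a + i * b = y] (mod int m)" "[a + j * b = z] (mod int m)"
        and ab': "[a' + i * b' = y] (mod int m)" "[a' + j * b' = z] (mod int m)"
        using inT[OF B(1,3,4) False] inT[OF B(2,5,6) False] by blast
      have i: "[a + i * b = a' + i * b'] (mod int m)" and j: "[a + j * b = a' + j * b'] (mod int m)"
        using ab ab' by (metis cong_trans cong_sym)+
      have "[(i - j) * b = (i - j) * b'] (mod int m)"
        using cong_diff[OF i j] by (simp add: algebra_simps)
      then have b: "[b = b'] (mod int m)"
        by (rule coprime_6_cancel_diff[OF m(1) False le])
      have "[a = a'] (mod int m)"
        using cong_diff[OF i cong_mult[OF cong_refl[of i] b]] by simp
      \<comment> \<open>The parameters of a line are arbitrary integers, so uniqueness means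
        equality as sets of points, which congruent parameters ensure.\<close>
      then have "(a + k * b) mod int m = (a' + k * b') mod int m" for k
        using b by (metis cong_def cong_add cong_mult cong_refl)
      then show ?thesis
        unfolding T T_def by simp
    qed
  qed
  moreover have "finite X" "card X = 4 * m + u"
  proof -
    show "finite X" unfolding X_def using finG by blast
    have "card X = (\<Sum>i\<in>{0..<5}. card (G i))"
      unfolding X_def by (rule card_UN_disjoint) (auto simp: G_def)
    also have "{0..<5::int} = {0, 1, 2, 3, 4}" by auto
    finally show "card X = 4 * m + u" by (simp add: cardG)
  qed
  ultimately show ?thesis
    using rainbow_card_cong by (metis card_atLeastLessThan diff_zero finite_atLeastLessThan)
qed

section \<open>Classes developed cyclically from one base class\<close>

text \<open>The last assumption says that each difference \<open>y - x\<close> from level \<open>i\<close> to level \<open>j\<close> occurs only once.\<close>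
lemma rainbow_starter:
  fixes n :: int
  assumes n: "n > 0"
    and fib: "fibre 0 \<in> S"
    and sub: "\<And>A. A \<in> S \<Longrightarrow> A \<subseteq> {0..<n} \<times> {0..<3}"
    and card: "\<And>A. A \<in> S \<Longrightarrow> card A = 3"
    and cover: "\<And>p. p \<in> {0..<n} \<times> {0..<3} \<Longrightarrow> \<exists>A\<in>S. p \<in> A"
    and disj: "\<And>A B p. A \<in> S \<Longrightarrow> B \<in> S \<Longrightarrow> p \<in> A \<Longrightarrow> p \<in> B \<Longrightarrow> A = B"
    and diff: "\<And>A B x y x' y' i j. A \<in> S \<Longrightarrow> B \<in> S \<Longrightarrow> (x, i) \<in> A \<Longrightarrow> (y, j) \<in> A \<Longrightarrow> (x, i) \<noteq> (y, j) \<Longrightarrow>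
                 (x', i) \<in> B \<Longrightarrow> (y', j) \<in> B \<Longrightarrow> [y - x = y' - x'] (mod n) \<Longrightarrow> x = x'"
  shows "rainbow {0..<n}"
proof -
  define sh where "sh s p = ((fst p + s) mod n, snd p :: int)" for s :: int and p :: "int \<times> int"
  define C where "C s = (`) (sh s) ` S" for s
  let ?P = "{0..<n} \<times> {0..<3::int}"
  have sh_P: "sh s p \<in> ?P" if "p \<in> ?P" for s p
    using that n by (auto simp: sh_def)
  have sh_sh: "sh s (sh t p) = p" if "p \<in> ?P" "s + t = 0" for s t p
    using that by (auto simp: sh_def mod_simps add.assoc add.commute[of t])
  have sh_inj: "inj_on (sh s) ?P" for s
    by (rule inj_on_inverseI[of _ "sh (- s)"]) (simp add: sh_sh)
  have "rainbow_classes {0..<n} C"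
  proof (rule rainbow_classesI)
    fix s assume s: "s \<in> {0..<n}"
    have "fibre s = sh s ` fibre 0"
      using s by (force simp: fibre_def sh_def)
    then show "fibre s \<in> C s"
      using fib by (auto simp: C_def)
    show "A \<subseteq> ?P" if "A \<in> C s" for A
      using that sub sh_P unfolding C_def by blast
    show "card A = 3" if "A \<in> C s" for A
      using that card sub inj_on_subset[OF sh_inj] unfolding C_def by (auto simp: card_image)
    show "\<exists>A\<in>C s. p \<in> A" if p: "p \<in> ?P" for p
    proof -
      obtain A where "A \<in> S" "sh (- s) p \<in> A"
        using cover[OF sh_P[OF p]] by blast
      moreover have "p = sh s (sh (- s) p)"
        using sh_sh[OF p] by simp
      ultimately show ?thesis
        unfolding C_def by blast
    qed
    show "A = B" if AB_in: "A \<in> C s" "B \<in> C s" "p \<in> A" "p \<in> B" for A B p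
    proof -
      obtain A0 B0 q r where AB: "A = sh s ` A0" "B = sh s ` B0" "A0 \<in> S" "B0 \<in> S"
        and qr: "q \<in> A0" "r \<in> B0" "p = sh s q" "p = sh s r"
        using AB_in unfolding C_def by blast
      have "q = r"
        using inj_onD[OF sh_inj[of s], of q r] qr AB sub by blast
      then show ?thesis
        using disj AB qr by metis
    qed
    fix t A B p q
    assume t: "t \<in> {0..<n}" and A: "A \<in> C s" and B: "B \<in> C t"
      and pq: "p \<in> A" "p \<in> B" "q \<in> A" "q \<in> B" "p \<noteq> q"
    obtain A0 B0 where AB: "A = sh s ` A0" "B = sh t ` B0" "A0 \<in> S" "B0 \<in> S"
      using A B unfolding C_def by blast
    obtain x i y j where A0: "(x, i) \<in> A0" "(y, j) \<in> A0" "p = sh s (x, i)" "q = sh s (y, j)"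
      using pq(1,3) unfolding AB by fast
    obtain x' i' y' j' where B0: "(x', i') \<in> B0" "(y', j') \<in> B0" "p = sh t (x', i')" "q = sh t (y', j')"
      using pq(2,4) unfolding AB by fast
    \<comment> \<open>Subtracting the two congruences cancels the shifts s and t. Equal differences
      then identify x with x', and the first congruence gives s = t.\<close>
    have ij: "i' = i" "j' = j" and x: "[x + s = x' + t] (mod n)" and y: "[y + s = y' + t] (mod n)"
      using A0 B0 by (auto simp: sh_def cong_def)
    have "[y - x = y' - x'] (mod n)"
      using cong_diff[OF y x] by simp
    then have "x = x'"
      using diff[OF AB(3,4) A0(1,2) _ B0(1,2)[unfolded ij]] A0 pq(5) by blast
    then have "[s = t] (mod n)"
      using x by (simp add: cong_add_lcancel)
    then show "s = t"
      using s t by (simp add: cong_def)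
  qed
  then show ?thesis
    unfolding rainbow_def by blast
qed

text \<open>The starter consists of the triples with first coordinates x, 2x, 3x on levels 0, 1, 2.
  Multiplication by 1, 2 and 3 permutes the residues, so these triples partition the points, and x =
  0 gives the fibre. The difference from level i to level j is (j - i) x, which determines x because
  j - i is invertible.\<close>

lemma rainbow_coprime_6:
  fixes n :: int
  assumes n: "coprime n 6" "n > 0"
  shows "rainbow {0..<n}"
proof -
  define T where "T x = (\<lambda>i. ((i + 1) * x mod n, i)) ` {0..<3}" for x
  have T_iff: "(y, i) \<in> T x \<longleftrightarrow> i \<in> {0..<3} \<and> y = (i + 1) * x mod n" for x y i
    unfolding T_def by auto
  show ?thesis
  proof (rule rainbow_starter[where S = "T ` {0..<n}"])
    show "n > 0" by fact
    have "fibre 0 = T 0"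
      unfolding fibre_def T_def by auto
    then show "fibre 0 \<in> T ` {0..<n}"
      using n by auto
    show "A \<subseteq> {0..<n} \<times> {0..<3}" if "A \<in> T ` {0..<n}" for A
      using that n unfolding T_def by auto
    show "card A = 3" if "A \<in> T ` {0..<n}" for A
      using that unfolding T_def by (auto simp: card_image inj_on_def)
    show "\<exists>A\<in>T ` {0..<n}. p \<in> A" if "p \<in> {0..<n} \<times> {0..<3}" for p
    proof -
      obtain y i where p: "p = (y, i)" "y \<in> {0..<n}" "i \<in> {0..<3}"
        using \<open>p \<in> _\<close> by blast
      \<comment> \<open>Prescribing the value 0 on an auxiliary level -1 forces a = b modulo n, so
        the line through both points has the form (i + 1) b.\<close>
      have "\<bar>i - (-1)\<bar> \<le> 4" "i \<noteq> -1" using p by auto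
      then obtain a b where ab: "[a + i * b = y] (mod n)" "[a + (-1) * b = 0] (mod n)"
        using coprime_6_solve[OF n, of i "-1"] by blast
      have "[(i + 1) * b = y] (mod n)"
        using cong_diff[OF ab] by (simp add: algebra_simps)
      then have "(y, i) \<in> T (b mod n)"
        using p by (simp add: T_iff cong_def mod_simps)
      then show ?thesis
        using n p by auto
    qed
    show "A = B" if AB: "A \<in> T ` {0..<n}" "B \<in> T ` {0..<n}" "p \<in> A" "p \<in> B" for A B p
    proof -
      obtain x y where xy: "A = T x" "B = T y" "x \<in> {0..<n}" "y \<in> {0..<n}"
        using AB(1,2) by blast
      obtain z i where p: "p = (z, i)" by fastforce
      have "[(i + 1) * x = (i + 1) * y] (mod n)" "i + 1 \<ge> 1" "i + 1 \<le> 4"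
        using AB(3,4) unfolding xy p T_iff by (auto simp: cong_def)
      then have "[x = y] (mod n)"
        using coprime_6_cancel[OF n(1)] by blast
      then show ?thesis
        using xy by (simp add: cong_def)
    qed
    fix A B x y x' y' i j
    assume "A \<in> T ` {0..<n}" "B \<in> T ` {0..<n}"
      and xy: "(x, i) \<in> A" "(y, j) \<in> A" "(x, i) \<noteq> (y, j)" "(x', i) \<in> B" "(y', j) \<in> B" "[y - x = y' - x'] (mod n)"
    then obtain a b where ab: "A = T a" "B = T b" "a \<in> {0..<n}" "b \<in> {0..<n}"
      by blast
    have T: "i \<in> {0..<3}" "j \<in> {0..<3}" "x = (i + 1) * a mod n" "y = (j + 1) * a mod n"
      "x' = (i + 1) * b mod n" "y' = (j + 1) * b mod n"
      using xy unfolding ab T_iff by auto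
    have "[(j + 1) * a - (i + 1) * a = (j + 1) * b - (i + 1) * b] (mod n)"
      using xy(6) unfolding T cong_def by (simp add: mod_simps)
    then have "[(j - i) * a = (j - i) * b] (mod n)"
      by (simp add: algebra_simps)
    moreover have "j \<noteq> i" "\<bar>j - i\<bar> \<le> 4"
      using T xy(3) by auto
    ultimately have "[a = b] (mod n)"
      using coprime_6_cancel_diff[OF n(1)] by blast
    then show "x = x'"
      using ab T by (simp add: cong_def)
  qed
qed

section \<open>Cyclic starters\<close>

text \<open>A quicksort-style distinctness test: the quadratic code equations of \<^const>\<open>distinct\<close> are too slow
  for \<open>code_simp\<close> on the difference lists below.\<close>
fun distinct_qs :: "'a::linorder list \<Rightarrow> bool" where
  "distinct_qs [] \<longleftrightarrow> True"
| "distinct_qs (x # xs) \<longleftrightarrow> \<not> List.member xs x \<and>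
     distinct_qs (filter (\<lambda>y. y < x) xs) \<and> distinct_qs (filter (\<lambda>y. x < y) xs)"

text \<open>An entry that is repeated differs from x, so all its copies survive in the same one of
  the two filtered lists.\<close>

lemma distinct_of_filter:
  fixes x :: "'a::linorder"
  assumes "x \<notin> set xs" "distinct (filter (\<lambda>y. y < x) xs)" "distinct (filter (\<lambda>y. x < y) xs)"
  shows "distinct xs"
  using assms by (induction xs) (auto split: if_splits)

lemma distinct_qs: "distinct_qs xs \<Longrightarrow> distinct xs"
  by (induction xs rule: distinct_qs.induct) (auto intro: distinct_of_filter)

definition points :: "('a \<times> 'a \<times> 'a) list \<Rightarrow> 'a list" where
  "points T = concat (map (\<lambda>(p, q, r). [p, q, r]) T)"

definition ordered_pairs :: "('a \<times> 'a \<times> 'a) list \<Rightarrow> ('a \<times> 'a) list" where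
  "ordered_pairs T = concat (map (\<lambda>(p, q, r). [(p, q), (p, r), (q, p), (q, r), (r, p), (r, q)]) T)"

text \<open>In a starter of length \<open>n\<close>, the integer \<open>p\<close> encodes the point \<open>(p mod n, p div n)\<close>, and
  \<open>difference\<close> encodes both levels and the difference of two points in one integer.\<close>
definition difference :: "int \<Rightarrow> int \<times> int \<Rightarrow> int" where
  "difference n = (\<lambda>(p, q). (3 * (p div n) + q div n) * n + (q - p) mod n)"

text \<open>The triple (0, n, 2n) encodes the fibre over 0. Covering follows by counting: n triples
  with distinct entries in the range already use up all 3n points.\<close>

definition is_starter :: "(int \<times> int \<times> int) list \<Rightarrow> bool" where
  "is_starter T \<longleftrightarrow> (let n = int (length T) in
     List.member T (0, n, 2 * n) \<and>
     list_all (\<lambda>p. 0 \<le> p \<and> p < 3 * n) (points T) \<and>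
     distinct_qs (points T) \<and>
     distinct_qs (map (difference n) (ordered_pairs T)))"

lemma rainbow_is_starter:
  assumes "is_starter T"
  shows "rainbow {0..<int (length T)}"
proof -
  define n where "n = int (length T)"
  define lst where "lst = (\<lambda>(p, q, r). [p, q, r :: int])"
  define pts where "pts t = set (lst t)" for t
  define dec where "dec p = (p mod n, p div n)" for p
  have mem: "(0, n, 2 * n) \<in> set T"
    and range: "\<And>p. p \<in> set (points T) \<Longrightarrow> 0 \<le> p \<and> p < 3 * n"
    and dist: "distinct (points T)"
    and dist_diff: "distinct (map (difference n) (ordered_pairs T))"
    using assms distinct_qs unfolding is_starter_def Let_def n_def[symmetric] list_all_iff List.member_iff by blast+
  have n: "n > 0"
    using mem unfolding n_def by auto
  have pts_sub: "pts t \<subseteq> set (points T)" if "t \<in> set T" for t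
    using that by (auto simp: pts_def points_def lst_def)
  have dec_inv: "n * snd (dec p) + fst (dec p) = p" for p
    by (simp add: dec_def)
  have dec_range: "dec p \<in> {0..<n} \<times> {0..<3}" if "p \<in> set (points T)" for p
  proof -
    have "n * (p div n) < n * 3"
      using dec_inv[of p] range[OF that] pos_mod_sign[OF n, of p] unfolding dec_def fst_conv snd_conv by linarith
    then have "p div n < 3"
      using n by (simp only: mult_less_cancel_left_pos)
    then show ?thesis
      using range[OF that] n by (auto simp: dec_def pos_imp_zdiv_nonneg_iff)
  qed
  have dec_inj: "dec p = dec q \<Longrightarrow> p = q" for p q
    by (metis dec_inv)
  have points: "points T = concat (map lst T)"
    by (simp add: points_def lst_def)
  have lst_inj: "lst t = lst t' \<longleftrightarrow> t = t'" for t t'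
    by (cases t; cases t') (simp add: lst_def)
  have pts_dist: "distinct (lst t)" if "t \<in> set T" for t
    using dist that unfolding points distinct_concat_iff by simp
  have pts_disj: "t = t'" if "t \<in> set T" "t' \<in> set T" "p \<in> pts t" "p \<in> pts t'" for t t' p
  proof (rule ccontr)
    assume "t \<noteq> t'"
    then have "set (lst t) \<inter> set (lst t') = {}"
      using dist that(1,2) lst_inj[of t t'] unfolding points distinct_concat_iff by simp
    then show False
      using that(3,4) unfolding pts_def by blast
  qed
  have set_points: "set (points T) = {0..<3 * n}"
  proof (rule card_subset_eq)
    show "set (points T) \<subseteq> {0..<3 * n}" using range by auto
    have "length (points T) = 3 * length T"
      unfolding points_def by (induction T) auto
    then show "card (set (points T)) = card {0..<3 * n}"
      using dist by (simp add: distinct_card n_def)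
  qed simp
  have pairs: "(p, q) \<in> set (ordered_pairs T)" if "t \<in> set T" "p \<in> pts t" "q \<in> pts t" "p \<noteq> q" for p q t
  proof -
    have "(p, q) \<in> set ((\<lambda>(p, q, r). [(p, q), (p, r), (q, p), (q, r), (r, p), (r, q)]) t)"
      using that(2-4) by (cases t) (auto simp: pts_def lst_def)
    then show ?thesis
      using that(1) unfolding ordered_pairs_def set_concat set_map by blast
  qed
  have "rainbow {0..<n}"
  proof (rule rainbow_starter[where S = "(\<lambda>t. dec ` pts t) ` set T"])
    show "n > 0" by fact
    have "dec ` pts (0, n, 2 * n) = fibre 0"
      using n by (auto simp: pts_def lst_def dec_def fibre_def)
    then show "fibre 0 \<in> (\<lambda>t. dec ` pts t) ` set T"
      using mem by (metis imageI)
    show "A \<subseteq> {0..<n} \<times> {0..<3}" if "A \<in> (\<lambda>t. dec ` pts t) ` set T" for A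
      using that dec_range pts_sub by blast
    show "card A = 3" if A: "A \<in> (\<lambda>t. dec ` pts t) ` set T" for A
    proof -
      obtain t where t: "t \<in> set T" "A = dec ` pts t" using A by blast
      have "card A = card (pts t)"
        unfolding t(2) by (intro card_image inj_onI) (rule dec_inj)
      also have "\<dots> = 3"
        unfolding pts_def distinct_card[OF pts_dist[OF t(1)]] by (cases t) (simp add: lst_def)
      finally show ?thesis .
    qed
    show "\<exists>A\<in>(\<lambda>t. dec ` pts t) ` set T. x \<in> A" if x: "x \<in> {0..<n} \<times> {0..<3}" for x
    proof -
      obtain y i where y: "x = (y, i)" "0 \<le> y" "y < n" "0 \<le> i" "i < 3" using x by auto
      have "dec (i * n + y) = x"
        using y by (simp add: dec_def)
      moreover have "i * n + y \<in> {0..<3 * n}"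
      proof -
        have "0 \<le> i * n" "i * n \<le> 2 * n"
          using y n by (auto intro: mult_right_mono)
        then show ?thesis
          using y unfolding atLeastLessThan_iff by linarith
      qed
      then have "\<exists>t\<in>set T. i * n + y \<in> pts t"
        unfolding set_points[symmetric] points pts_def by simp
      ultimately show ?thesis by blast
    qed
    show "A = B" if AB: "A \<in> (\<lambda>t. dec ` pts t) ` set T" "B \<in> (\<lambda>t. dec ` pts t) ` set T" "x \<in> A" "x \<in> B" for A B x
    proof -
      obtain t t' where t: "t \<in> set T" "A = dec ` pts t" "t' \<in> set T" "B = dec ` pts t'"
        using AB(1,2) by blast
      obtain p q where "p \<in> pts t" "x = dec p" "q \<in> pts t'" "x = dec q"
        using AB(3,4) unfolding t by blast
      then show ?thesis
        using dec_inj[of p q] pts_disj[of t t' p] t by simp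
    qed
    fix A B x y x' y' i j
    assume "A \<in> (\<lambda>t. dec ` pts t) ` set T" "B \<in> (\<lambda>t. dec ` pts t) ` set T"
      and xy: "(x, i) \<in> A" "(y, j) \<in> A" "(x, i) \<noteq> (y, j)" "(x', i) \<in> B" "(y', j) \<in> B"
      and cong: "[y - x = y' - x'] (mod n)"
    then obtain t t' where t: "t \<in> set T" "A = dec ` pts t" "t' \<in> set T" "B = dec ` pts t'"
      by blast
    obtain p q where pq: "p \<in> pts t" "q \<in> pts t" "(x, i) = dec p" "(y, j) = dec q"
      using xy(1,2) unfolding t by blast
    obtain p' q' where pq': "p' \<in> pts t'" "q' \<in> pts t'" "(x', i) = dec p'" "(y', j) = dec q'"
      using xy(4,5) unfolding t by blast
    have "p \<noteq> q" using pq xy(3) by auto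
    \<comment> \<open>\<open>ordered_pairs\<close> contains no pair of equal points. If p' and q'
      coincided, i = j and x, y would be congruent residues, so the first two points would coincide
      as well.\<close>
    moreover have "p' \<noteq> q'"
    proof
      assume "p' = q'"
      then have "(x', i) = (y', j)"
        unfolding pq'(3,4) by simp
      then have "i = j" "[y = x] (mod n)"
        using cong by (auto simp: cong_iff_dvd_diff)
      moreover have "x \<in> {0..<n}" "y \<in> {0..<n}"
        using pq n by (auto simp: dec_def)
      ultimately show False
        using xy(3) by (simp add: cong_def)
    qed
    ultimately have "(p, q) \<in> set (ordered_pairs T)" "(p', q') \<in> set (ordered_pairs T)"
      using pairs t(1,3) pq(1,2) pq'(1,2) by blast+
    \<comment> \<open>Both pairs have levels i, j and the same difference modulo n, so they are the
      same entry of a list without repetitions.\<close>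
    moreover have "difference n (p, q) = difference n (p', q')"
      using pq(3,4) pq'(3,4) cong by (simp add: difference_def dec_def cong_def mod_simps)
    ultimately have "p = p'"
      using dist_diff by (auto simp: distinct_map dest: inj_onD)
    then show "x = x'"
      using pq(3) pq'(3) by (metis fst_conv)
  qed
  then show ?thesis
    by (simp add: n_def)
qed

text \<open>Found by simulated annealing on the number of repeated differences.\<close>
definition starters :: "(int \<times> int \<times> int) list list" where
  "starters = [
     [(0,4,8), (3,6,9), (1,2,7), (5,10,11)],
     [(0,6,12), (1,5,10), (4,8,17), (9,14,16), (2,3,13), (7,11,15)],
     [(0,8,16), (3,6,18), (11,21,22), (13,15,19), (4,10,23), (5,9,14), (1,2,12), (7,17,20)],
     [(0,9,18), (2,10,13), (5,7,24), (17,21,25), (3,4,26), (8,12,19), (14,15,20), (1,6,16),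
     (11,22,23)],
     [(0,10,20), (3,7,15), (12,19,28), (11,22,26), (6,17,29), (16,23,24), (8,13,14), (2,5,27),
     (1,9,25), (4,18,21)],
     [(0,12,24), (16,19,30), (13,23,32), (1,31,33), (20,28,35), (2,7,29), (11,15,25), (5,8,9),
     (4,6,14), (3,18,34), (10,26,27), (17,21,22)],
     [(0,14,28), (2,33,39), (5,6,27), (3,12,30), (1,20,24), (10,32,36), (17,22,41), (19,34,35),
     (4,16,37), (18,31,40), (25,26,29), (8,21,23), (9,15,38), (7,11,13)],
     [(0,15,30), (1,7,23), (9,10,41), (5,8,44), (2,19,43), (12,32,35), (6,16,39), (34,36,40),
     (4,14,18), (13,25,42), (22,26,27), (17,37,38), (21,28,31), (3,11,24), (20,29,33)],
     [(0,16,32), (7,30,36), (25,26,43), (3,24,38), (2,15,39), (10,35,46), (9,27,29), (33,37,47),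
     (4,8,18), (19,28,31), (1,6,34), (5,17,22), (21,41,44), (11,20,45), (13,14,40), (12,23,42)],
     [(0,18,36), (20,27,35), (8,32,34), (11,44,50), (3,17,33), (14,24,25), (30,41,43), (10,39,47),
     (16,23,38), (22,28,45), (12,26,42), (15,19,49), (31,51,52), (2,9,40), (29,48,53), (5,13,37),
     (1,21,46), (4,6,7)],
     [(0,22,44), (43,48,53), (13,52,56), (41,50,62), (6,33,36), (11,25,49), (10,28,64), (4,19,38),
     (7,35,39), (3,27,29), (14,17,59), (8,16,37), (1,2,18), (34,40,63), (45,58,65), (5,46,54),
     (23,31,32), (20,51,57), (30,42,55), (15,24,61), (12,21,47), (9,26,60)],
     [(0,26,52), (7,48,53), (11,36,77), (2,24,38), (28,61,73), (3,56,63), (12,19,69), (8,37,45),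
     (14,32,42), (34,35,41), (18,67,76), (57,59,62), (30,44,74), (5,43,70), (13,40,72), (10,29,54),
     (15,49,66), (6,39,68), (4,47,51), (1,64,65), (50,60,71), (33,55,75), (21,23,27), (16,17,58),
     (9,20,25), (22,31,46)],
     [(0,27,54), (13,24,71), (20,31,76), (28,29,75), (6,16,36), (25,63,66), (32,39,41), (9,59,60),
     (5,11,33), (21,23,42), (2,47,57), (35,43,79), (40,64,68), (37,72,78), (44,56,69), (14,58,74),
     (15,38,48), (7,46,50), (8,65,77), (22,30,61), (4,19,26), (45,51,67), (3,17,34), (12,53,55),
     (1,73,80), (10,18,52), (49,62,70)],
     [(0,30,60), (13,25,42), (46,49,51), (20,33,78), (12,31,68), (3,6,84), (24,28,62), (11,22,55),
     (7,17,58), (15,52,81), (38,88,89), (37,71,75), (23,29,41), (34,50,86), (8,80,82), (14,45,54),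
     (27,43,67), (64,70,87), (18,65,79), (59,69,77), (40,47,53), (19,21,74), (5,39,85), (35,61,66),
     (9,26,48), (10,72,83), (32,44,76), (4,36,63), (1,56,57), (2,16,73)],
     [(0,36,72), (38,81,98), (100,105,107), (5,47,102), (7,57,71), (17,54,56), (53,58,59),
     (8,62,96), (18,20,29), (10,45,93), (55,84,88), (52,80,92), (21,51,89), (48,73,95), (4,33,83),
     (34,43,66), (2,12,103), (1,23,24), (27,50,91), (14,74,99), (3,6,87), (16,40,69), (28,39,90),
     (25,46,78), (61,70,79), (11,15,37), (64,68,94), (30,86,101), (19,44,63), (13,32,106),
     (22,60,97), (9,65,75), (35,77,104), (31,82,85), (41,49,76), (26,42,67)],
     [(0,38,76), (31,50,58), (21,60,63), (16,70,71), (22,25,99), (33,37,45), (40,85,107), (7,32,79),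
     (42,73,98), (8,39,105), (9,30,110), (26,56,91), (61,93,108), (78,86,113), (52,82,94),
     (29,80,90), (14,20,89), (1,72,87), (13,18,74), (53,65,104), (41,55,66), (24,36,81), (11,27,95),
     (34,48,69), (92,106,112), (47,57,109), (49,54,97), (67,83,84), (19,28,43), (5,101,103),
     (10,51,77), (75,102,111), (23,59,68), (17,35,88), (2,12,46), (6,96,100), (15,44,64), (3,4,62)],
     [(0,39,78), (25,49,93), (8,77,108), (71,75,91), (16,79,103), (7,18,60), (37,65,83), (35,43,90),
     (11,32,106), (2,29,98), (81,88,107), (24,97,105), (64,66,67), (19,40,68), (33,38,87),
     (36,80,96), (47,55,72), (12,50,62), (22,26,53), (5,48,114), (9,63,100), (57,92,95),
     (42,61,115), (1,46,102), (17,30,52), (3,44,89), (70,99,113), (28,31,110), (4,13,69),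
     (14,73,85), (15,23,112), (58,76,116), (20,27,56), (45,51,74), (59,84,101), (10,82,86),
     (41,94,104), (34,109,111), (6,21,54)],
     [(0,40,80), (18,41,68), (42,102,113), (21,104,118), (8,43,77), (61,63,79), (28,33,74),
     (4,71,95), (6,10,115), (35,37,90), (7,26,34), (44,88,106), (27,109,116), (62,87,89), (5,11,48),
     (53,65,83), (50,75,107), (29,55,105), (14,25,67), (17,84,85), (12,36,66), (13,39,51),
     (9,24,97), (2,19,78), (58,93,110), (22,32,94), (3,81,117), (1,46,99), (54,91,96), (23,72,100),
     (49,70,103), (45,52,56), (15,86,101), (64,111,119), (16,47,73), (31,38,59), (20,76,112),
     (57,60,108), (30,69,114), (82,92,98)],
     [(0,42,84), (13,30,102), (82,88,115), (11,48,59), (66,70,124), (6,64,94), (83,91,121),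
     (5,36,54), (4,55,125), (49,58,118), (31,43,107), (21,71,90), (41,79,92), (44,73,120),
     (7,53,68), (8,67,123), (25,28,60), (27,40,114), (39,61,101), (23,32,56), (1,20,97),
     (24,76,122), (10,96,113), (9,14,81), (57,62,80), (99,109,110), (17,108,112), (26,33,85),
     (100,106,119), (45,52,77), (15,72,93), (47,75,86), (50,95,117), (12,46,111), (18,63,98),
     (37,51,87), (22,89,105), (16,38,69), (19,35,116), (2,29,65), (3,74,103), (34,78,104)],
     [(0,46,92), (38,55,115), (47,69,108), (19,30,103), (60,100,131), (59,93,112), (13,70,99),
     (41,57,73), (22,58,105), (64,118,129), (53,68,104), (44,95,132), (6,37,96), (5,72,136),
     (12,18,87), (1,40,114), (11,88,133), (26,39,84), (20,50,102), (48,56,135), (2,21,91),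
     (16,81,130), (63,74,106), (35,107,113), (24,25,123), (61,111,124), (52,110,126), (71,80,101),
     (76,89,90), (54,120,137), (15,75,79), (3,45,86), (8,29,116), (36,83,127), (97,119,122),
     (34,42,82), (7,17,66), (4,78,85), (10,32,125), (31,33,94), (28,62,117), (9,43,109), (14,65,67),
     (23,98,134), (27,49,77), (51,121,128)],
     [(0,66,132), (2,80,103), (53,149,190), (30,173,174), (55,59,99), (1,117,167), (82,180,183),
     (25,123,156), (104,110,141), (106,114,197), (29,56,87), (40,112,161), (20,60,81), (71,86,139),
     (23,75,171), (3,27,185), (45,163,165), (129,140,151), (70,98,187), (50,52,79), (7,148,164),
     (35,44,124), (49,113,153), (17,51,125), (11,90,194), (43,62,192), (83,119,122), (85,94,107),
     (28,36,111), (116,155,159), (26,39,177), (21,181,186), (46,93,168), (48,105,130), (97,144,158),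
     (12,121,137), (74,109,182), (88,89,169), (15,100,120), (38,63,91), (5,72,96), (14,150,188),
     (69,138,145), (64,154,166), (6,61,68), (67,134,160), (54,84,143), (78,126,178), (58,118,128),
     (32,101,172), (8,108,115), (77,142,162), (127,133,191), (95,136,189), (76,102,131), (31,41,47),
     (22,57,176), (13,18,147), (16,19,65), (10,24,73), (34,184,193), (42,152,195), (4,33,175),
     (92,146,170), (157,179,196), (9,37,135)],
     [(0,70,140), (48,153,181), (60,93,168), (22,59,74), (4,6,72), (79,110,115), (75,165,167),
     (101,107,133), (82,95,171), (192,200,201), (37,68,135), (81,139,203), (24,103,104),
     (28,54,150), (3,16,63), (132,163,178), (12,96,98), (116,160,194), (41,91,185), (144,169,188),
     (13,71,78), (84,87,152), (57,92,146), (17,55,173), (21,174,198), (25,126,197), (64,94,177),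
     (1,26,56), (36,175,186), (109,137,190), (97,105,114), (9,145,202), (2,183,189), (151,161,204),
     (23,187,191), (7,35,176), (27,46,47), (11,40,123), (49,73,106), (86,136,143), (20,130,196),
     (65,108,180), (90,170,199), (52,88,195), (34,125,159), (113,124,154), (111,127,206),
     (31,45,166), (134,148,155), (5,69,156), (43,50,208), (66,77,100), (39,61,117), (83,142,182),
     (129,172,184), (44,118,205), (15,122,164), (141,162,193), (42,51,102), (89,99,209),
     (14,67,128), (112,157,179), (29,32,53), (76,80,149), (30,119,138), (33,121,207), (10,18,147),
     (38,120,158), (8,19,62), (58,85,131)]]"

lemma is_starter_starters: "list_all is_starter starters"
  by code_simp

text \<open>These are exactly the orders n \<ge> 4 not coprime to 6 for which
  \<open>td_parameters\<close> has no admissible m.\<close>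

lemma starter_lengths:
  "map length starters = [4, 6, 8, 9, 10, 12, 14, 15, 16, 18, 22, 26, 27, 30, 36, 38, 39, 40, 42, 46, 66, 70]"
  by (simp add: starters_def)

lemma rainbow_starters:
  assumes "n \<in> set (map length starters)"
  shows "rainbow {0..<n}"
proof -
  obtain T where T: "T \<in> set starters" "n = length T"
    using assms by auto
  then have "rainbow {0..<int n}"
    using is_starter_starters rainbow_is_starter by (simp add: list_all_iff)
  then show ?thesis
    by (rule rainbow_card_cong) auto
qed

section \<open>All orders from 4 on\<close>

lemma coprime_6_mod:
  fixes m :: nat
  assumes "m mod 6 = 1 \<or> m mod 6 = 5"
  shows "coprime (int m) 6"
proof -
  have "coprime (m mod 6) 6"
    using assms by (auto simp: coprime_iff_gcd_eq_1 gcd_non_0_nat)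
  then show ?thesis
    by (metis coprime_mod_left_iff coprime_int_iff of_nat_numeral zero_neq_numeral)
qed

text \<open>The truncated group of size u = n - 4m must itself be manageable: u at most 1 needs
  nothing and u \<ge> 4 is left to induction, which excludes 2 and 3.\<close>

lemma td_parameters:
  fixes n :: nat
  assumes "n \<ge> 4" "n mod 6 \<noteq> 1" "n mod 6 \<noteq> 5" "n \<notin> set (map length starters)"
  shows "\<exists>m. (m mod 6 = 1 \<or> m mod 6 = 5) \<and> 5 \<le> m \<and> 4 * m \<le> n \<and> n \<le> 5 * m \<and>
    n - 4 * m \<noteq> 2 \<and> n - 4 * m \<noteq> 3"
proof (cases "n < 92")
  case True
  have "\<forall>n\<in>{4..<92::nat}. n mod 6 = 1 \<or> n mod 6 = 5 \<or>
    n \<in> set [4, 6, 8, 9, 10, 12, 14, 15, 16, 18, 22, 26, 27, 30, 36, 38, 39, 40, 42, 46, 66, 70] \<or>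
    (\<exists>m\<in>{5, 7, 11, 13, 17, 19}. 4 * m \<le> n \<and> n \<le> 5 * m \<and> n - 4 * m \<noteq> 2 \<and> n - 4 * m \<noteq> 3)"
    by (simp flip: set_upt)
  then have "\<exists>m\<in>{5, 7, 11, 13, 17, 19}. 4 * m \<le> n \<and> n \<le> 5 * m \<and> n - 4 * m \<noteq> 2 \<and> n - 4 * m \<noteq> 3"
    using assms True unfolding starter_lengths by (meson atLeastLessThan_iff)
  then obtain m where m: "m \<in> {5, 7, 11, 13, 17, 19}" "4 * m \<le> n \<and> n \<le> 5 * m \<and> n - 4 * m \<noteq> 2 \<and> n - 4 * m \<noteq> 3"
    by blast
  then have "m mod 6 = 1 \<or> m mod 6 = 5" "5 \<le> m"
    by auto
  then show ?thesis
    using m(2) by blast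
next
  case False
  \<comment> \<open>q is the largest m with n - 4m \<ge> 4. For m \<ge> q - 3 one has n \<le> 4m +
    19, which is at most 5m once m \<ge> 19; this explains the threshold n = 92, where q reaches
    22.\<close>
  define q where "q = (n - 4) div 4"
  have q: "4 * q + 4 \<le> n" "n \<le> 4 * q + 7" "q \<ge> 22"
    using False unfolding q_def by linarith+
  \<comment> \<open>Consecutive integers coprime to 6 are at most 4 apart, so four successive
    integers contain one.\<close>
  have "\<exists>m. (m mod 6 = 1 \<or> m mod 6 = 5) \<and> q - 3 \<le> m \<and> m \<le> q"
    using q(3) by presburger
  then obtain m where "m mod 6 = 1 \<or> m mod 6 = 5" "q - 3 \<le> m" "m \<le> q"
    by blast
  then show ?thesis
    using q by (intro exI[of _ m]) auto
qed

lemma rainbow_ge_4: "n \<ge> 4 \<Longrightarrow> rainbow {0..<n::nat}"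
proof (induction n rule: less_induct)
  case (less n)
  show ?case
  proof (cases "n \<in> set (map length starters)")
    case True
    then show ?thesis by (rule rainbow_starters)
  next
    case False
    show ?thesis
    proof (cases "n mod 6 = 1 \<or> n mod 6 = 5")
      case True
      have "rainbow {0..<int n}"
        using rainbow_coprime_6[OF coprime_6_mod[OF True]] less.prems by simp
      then show ?thesis
        by (rule rainbow_card_cong) auto
    next
      assume "\<not> (n mod 6 = 1 \<or> n mod 6 = 5)"
      then obtain m where m: "m mod 6 = 1 \<or> m mod 6 = 5" "5 \<le> m" "4 * m \<le> n" "n \<le> 5 * m"
        "n - 4 * m \<noteq> 2" "n - 4 * m \<noteq> 3"
        using td_parameters less.prems False by blast
      define u where "u = n - 4 * m"
      have "u \<le> 1 \<or> rainbow {0..<u}"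
      proof (cases "u \<le> 1")
        case False
        then show ?thesis
          using less.IH[of u] m unfolding u_def by linarith
      qed simp
      \<comment> \<open>Here n \<ge> 4m \<ge> 20, so m, 4 and 5 are all below n.\<close>
      moreover have "rainbow {0..<m}" "rainbow {0..<4::nat}" "rainbow {0..<5::nat}"
        using less.IH m by auto
      moreover have "n = 4 * m + u" "u \<le> m"
        using m unfolding u_def by auto
      ultimately show ?thesis
        using rainbow_truncated_td[of m u] coprime_6_mod[OF m(1)] m(2) by simp
    qed
  qed
qed

section \<open>Packings\<close>

text \<open>The empty packing makes the set of sizes nonempty, and finiteness of the power set
  bounds it, so \<open>Max\<close> is a member of the set.\<close>

lemma D_attained: "\<exists>B. is_packing {0..<m} B k \<and> card B = D m k"
proof -
  let ?S = "{card B | B. is_packing {0..<m} B k}"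
  have "?S \<subseteq> card ` Pow (Pow {0..<m})"
    unfolding is_packing_def by blast
  then have "finite ?S"
    by (rule finite_subset) simp
  moreover have "is_packing {0..<m} {} k"
    by (simp add: is_packing_def)
  then have "?S \<noteq> {}"
    by blast
  ultimately have "D m k \<in> ?S"
    unfolding D_def by (rule Max_in)
  then show ?thesis
    by auto
qed

text \<open>Counting blocks through a pair becomes uniqueness of the block. This rests on B being
  finite, since \<open>card\<close> is 0 on infinite sets; points outside X lie in no block, so x
  and y may range over everything.\<close>

lemma is_packing_iff:
  "is_packing X B k \<longleftrightarrow> finite X \<and> (\<forall>b\<in>B. b \<subseteq> X \<and> card b = k) \<and>
     (\<forall>b\<in>B. \<forall>c\<in>B. \<forall>x y. x \<noteq> y \<longrightarrow> {x, y} \<subseteq> b \<inter> c \<longrightarrow> b = c)"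
proof (cases "finite X \<and> (\<forall>b\<in>B. b \<subseteq> X \<and> card b = k)")
  case True
  then have "B \<subseteq> Pow X" by blast
  then have fin: "finite B"
    using True by (simp add: finite_subset)
  have "card {b \<in> B. x \<in> b \<and> y \<in> b} \<le> 1 \<longleftrightarrow> (\<forall>b\<in>B. \<forall>c\<in>B. {x, y} \<subseteq> b \<inter> c \<longrightarrow> b = c)" for x y
    using fin card_le_Suc0_iff_eq[of "{b \<in> B. x \<in> b \<and> y \<in> b}"] by auto
  moreover have "(\<forall>x\<in>X. \<forall>y\<in>X. x \<noteq> y \<longrightarrow> (\<forall>b\<in>B. \<forall>c\<in>B. {x, y} \<subseteq> b \<inter> c \<longrightarrow> b = c)) \<longleftrightarrow>
    (\<forall>b\<in>B. \<forall>c\<in>B. \<forall>x y. x \<noteq> y \<longrightarrow> {x, y} \<subseteq> b \<inter> c \<longrightarrow> b = c)" (is "?L \<longleftrightarrow> ?R")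
  proof
    assume L: ?L
    show ?R
    proof (intro ballI allI impI)
      fix b c x y assume h: "b \<in> B" "c \<in> B" "x \<noteq> y" "{x, y} \<subseteq> b \<inter> c"
      then have "x \<in> X" "y \<in> X"
        using \<open>B \<subseteq> Pow X\<close> by auto
      then show "b = c"
        using L h by metis
    qed
  next
    assume ?R
    then show ?L by metis
  qed
  ultimately show ?thesis
    using True by (simp only: is_packing_def)
qed (auto simp: is_packing_def)

text \<open>Serves to move the construction from a sum type to the natural numbers.\<close>

lemma packing_image:
  assumes "is_packing X B k" "inj_on f X"
  shows "is_packing (f ` X) ((`) f ` B) k" "card ((`) f ` B) = card B"
    "largest_ppc_size B r \<Longrightarrow> largest_ppc_size ((`) f ` B) r"
proof -
  have B: "b \<subseteq> X" "card b = k" if "b \<in> B" for b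
    using assms(1) that by (auto simp: is_packing_def)
  have inter: "f ` b \<inter> f ` c = f ` (b \<inter> c)" if "b \<in> B" "c \<in> B" for b c
    using inj_on_image_Int[OF assms(2)] B that by blast
  have inj: "inj_on ((`) f) B"
    using B by (intro inj_on_subset[OF inj_on_image_Pow[OF assms(2)]]) blast
  then show "card ((`) f ` B) = card B"
    by (rule card_image)
  show "is_packing (f ` X) ((`) f ` B) k"
    unfolding is_packing_iff
  proof (intro conjI ballI allI impI)
    show "finite (f ` X)"
      using assms(1) by (simp add: is_packing_def)
    show "b \<subseteq> f ` X" "card b = k" if "b \<in> (`) f ` B" for b
      using that B inj_on_subset[OF assms(2)] by (auto simp: card_image)
    fix b c x y assume bc: "b \<in> (`) f ` B" "c \<in> (`) f ` B" and xy: "x \<noteq> y" "{x, y} \<subseteq> b \<inter> c"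
    obtain b0 c0 where b0: "b0 \<in> B" "c0 \<in> B" "b = f ` b0" "c = f ` c0"
      using bc by blast
    have "x \<in> f ` (b0 \<inter> c0)" "y \<in> f ` (b0 \<inter> c0)"
      using xy(2) unfolding inter[OF b0(1,2), symmetric] b0(3,4) by simp_all
    then obtain x0 y0 where xy0: "{x0, y0} \<subseteq> b0 \<inter> c0" "x = f x0" "y = f y0"
      by blast
    have "b0 = c0"
      using assms(1) b0(1,2) xy0 xy(1) unfolding is_packing_iff by metis
    then show "b = c"
      using b0 by simp
  qed
  \<comment> \<open>Injectivity preserves and reflects both distinctness and disjointness of blocks,
    and every subfamily of the image is the image of a subfamily.\<close>
  have ppc: "is_ppc ((`) f ` B) ((`) f ` P) \<longleftrightarrow> is_ppc B P" if "P \<subseteq> B" for P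
  proof -
    have "(f ` b \<noteq> f ` c \<longrightarrow> f ` b \<inter> f ` c = {}) \<longleftrightarrow> (b \<noteq> c \<longrightarrow> b \<inter> c = {})" if "b \<in> P" "c \<in> P" for b c
      using inj_on_eq_iff[OF inj] inter \<open>P \<subseteq> B\<close> that by (simp add: subset_iff)
    moreover have "(`) f ` P \<subseteq> (`) f ` B"
      using that by (rule image_mono)
    ultimately show ?thesis
      using that unfolding is_ppc_def ball_simps by (simp only: simp_thms cong: ball_cong)
  qed
  have card_P: "card ((`) f ` P) = card P" if "P \<subseteq> B" for P
    using that inj by (simp add: card_image inj_on_subset)
  assume "largest_ppc_size B r"
  then obtain P where P: "is_ppc B P" "card P = r" and no: "\<And>P. is_ppc B P \<Longrightarrow> card P \<noteq> r + 1"
    unfolding largest_ppc_size_def by blast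
  show "largest_ppc_size ((`) f ` B) r"
    unfolding largest_ppc_size_def
  proof (intro conjI notI)
    have "P \<subseteq> B" using P by (simp add: is_ppc_def)
    then show "\<exists>P. is_ppc ((`) f ` B) P \<and> card P = r"
      using ppc card_P P by metis
    assume "\<exists>P. is_ppc ((`) f ` B) P \<and> card P = r + 1"
    then obtain Q where Q: "is_ppc ((`) f ` B) Q" "card Q = r + 1" by blast
    then obtain P where "P \<subseteq> B" "Q = (`) f ` P"
      unfolding is_ppc_def by (meson subset_imageE)
    then show False
      using no ppc card_P Q by metis
  qed
qed

section \<open>The packing built from a rainbow system\<close>

lemma card_rainbow_class:
  assumes C: "rainbow_classes X C" and "finite X" "x \<in> X"
  shows "finite (C x)" "card (C x) = card X"
proof -
  have sub: "C x \<subseteq> Pow (X \<times> {0..<3})"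
    using rainbow_subset[OF C \<open>x \<in> X\<close>] by blast
  then show fin: "finite (C x)"
    using \<open>finite X\<close> by (simp add: finite_subset)
  have un: "\<Union> (C x) = X \<times> {0..<3}"
    using sub rainbow_cover[OF C \<open>x \<in> X\<close>] by blast
  have "3 * card (C x) = card (\<Union> (C x))"
  proof (rule card_partition)
    show "finite (\<Union> (C x))" unfolding un using \<open>finite X\<close> by simp
    show "A \<inter> B = {}" if "A \<in> C x" "B \<in> C x" "A \<noteq> B" for A B
      using rainbow_disjoint[OF C \<open>x \<in> X\<close> that(1,2)] that(3) by blast
  qed (use fin rainbow_card[OF C \<open>x \<in> X\<close>] in auto)
  then show "card (C x) = card X"
    unfolding un by (simp add: card_cartesian_product)
qed

lemma packing_from_rainbow:
  fixes n \<rho> :: nat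
  assumes C: "rainbow_classes {0..<n} C" and "\<rho> \<le> n" and Q: "is_packing {0..<\<rho> + 1} Q 4"
  shows "\<exists>(X :: (nat \<times> int + nat) set) B. card X = 3 * n + 1 + \<rho> \<and> is_packing X B 4 \<and>
           card B = n * \<rho> + card Q \<and> largest_ppc_size B \<rho>"
proof -
  \<comment> \<open>The point \<open>Inr x\<close> with x < \<rho> extends the triples of class x;
    \<open>Inr \<rho>\<close> is the further point, met only by blocks of \<open>B2\<close>.\<close>
  define X where "X = Inl ` ({0..<n} \<times> {0..<3::int}) \<union> Inr ` {0..<\<rho> + 1}"
  define ext where "ext x A = insert (Inr x) (Inl ` A)" for x :: nat and A :: "(nat \<times> int) set"
  define B1 where "B1 = (\<Union>x\<in>{0..<\<rho>}. ext x ` C x)"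
  define B2 where "B2 = (`) (Inr :: nat \<Rightarrow> nat \<times> int + nat) ` Q"
  have blk: "A \<subseteq> {0..<n} \<times> {0..<3}" "card A = 3" "finite A" if "A \<in> C x" "x < \<rho>" for x A
    using rainbow_subset[OF C, of x A] rainbow_card[OF C, of x A] that \<open>\<rho> \<le> n\<close> card.infinite[of A] by auto
  have QB: "b \<subseteq> {0..<\<rho> + 1}" "card b = 4" if "b \<in> Q" for b
    using that Q unfolding is_packing_def by auto
  have Inl_ext: "Inl p \<in> ext x A \<longleftrightarrow> p \<in> A" and Inr_ext: "Inr y \<in> ext x A \<longleftrightarrow> y = x" for p x y A
    unfolding ext_def by auto
  have ext_inj: "ext x A = ext y A' \<longleftrightarrow> x = y \<and> A = A'" for x y A A'
  proof
    assume eq: "ext x A = ext y A'"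
    then show "x = y \<and> A = A'"
      using Inl_ext Inr_ext by (metis subset_antisym subsetI)
  qed simp
  have B1_cases: "\<exists>x A. x < \<rho> \<and> x < n \<and> A \<in> C x \<and> b = ext x A" if "b \<in> B1" for b
    using that \<open>\<rho> \<le> n\<close> unfolding B1_def by force
  have "card X = 3 * n + 1 + \<rho>"
    unfolding X_def by (subst card_Un_disjoint) (auto simp: card_image card_cartesian_product)
  moreover have "is_packing X (B1 \<union> B2) 4"
    unfolding is_packing_iff
  proof (intro conjI ballI allI impI)
    show "finite X" unfolding X_def by simp
    fix b assume "b \<in> B1 \<union> B2"
    then consider x A where "x < \<rho>" "A \<in> C x" "b = ext x A" | q where "q \<in> Q" "b = Inr ` q"
      unfolding B1_def B2_def by auto
    then have "b \<subseteq> X \<and> card b = 4"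
    proof cases
      case 1
      have "b \<subseteq> X"
        using blk(1)[OF 1(2,1)] 1(1) unfolding 1(3) ext_def X_def by auto
      have "Inr x \<notin> (Inl ` A :: (nat \<times> int + nat) set)" by auto
      then have "card b = 4"
        using blk(2,3)[OF 1(2,1)] unfolding 1(3) ext_def by (simp add: card_image)
      then show ?thesis
        using \<open>b \<subseteq> X\<close> by simp
    next
      case 2
      show ?thesis
        using QB[OF 2(1)] unfolding 2(2) X_def by (auto simp: card_image)
    qed
    then show "b \<subseteq> X" "card b = 4" by simp_all
  next
    \<comment> \<open>All points of a block in \<open>B2\<close> come from \<open>Inr\<close>,
      whereas a block in \<open>B1\<close> has just one such point.\<close>
    have mixed: False if bc: "b \<in> B1" "c \<in> B2" and xy: "x \<noteq> y" "{x, y} \<subseteq> b \<inter> c" for b c x y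
    proof -
      obtain z w where "x = Inr z" "y = Inr w"
        using bc(2) xy(2) unfolding B2_def by blast
      then show False
        using B1_cases[OF bc(1)] xy Inr_ext by auto
    qed
    fix b c x y
    assume bc: "b \<in> B1 \<union> B2" "c \<in> B1 \<union> B2" and xy: "x \<noteq> y" "{x, y} \<subseteq> b \<inter> c"
    consider "b \<in> B1" "c \<in> B1" | "b \<in> B2" "c \<in> B2" | "b \<in> B1" "c \<in> B2" | "b \<in> B2" "c \<in> B1"
      using bc by blast
    then show "b = c"
    proof cases
      case 1
      obtain s A t A' where b: "s < n" "A \<in> C s" "b = ext s A" and c: "t < n" "A' \<in> C t" "c = ext t A'"
        using B1_cases[OF 1(1)] B1_cases[OF 1(2)] by blast
      have "s = t \<and> A = A'"
      proof (cases "s = t")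
        case True
        obtain p where "p \<in> A" "p \<in> A'"
          using xy unfolding b(3) c(3) True by (auto simp: ext_def)
        then show ?thesis
          using True rainbow_disjoint[OF C, of s A A' p] b c by simp
      next
        case False
        \<comment> \<open>The only \<open>Inr\<close> points of the blocks are the distinct
          \<open>Inr s\<close> and \<open>Inr t\<close>, so both shared points belong to the
          triples.\<close>
        obtain p q where "p \<noteq> q" "p \<in> A" "p \<in> A'" "q \<in> A" "q \<in> A'"
          using xy False unfolding b(3) c(3) by (auto simp: ext_def)
        then show ?thesis
          using rainbow_pair[OF C, of s t A A' p q] b c by simp
      qed
      then show ?thesis using b c by simp
    next
      case 2
      obtain p q where pq: "p \<in> Q" "q \<in> Q" "b = Inr ` p" "c = Inr ` q"
        using 2 unfolding B2_def by blast
      then obtain x0 y0 where "x0 \<noteq> y0" "{x0, y0} \<subseteq> p \<inter> q"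
        using xy by blast
      then have "p = q"
        using Q pq unfolding is_packing_iff by blast
      then show ?thesis using pq by simp
    qed (use mixed xy in blast)+
  qed
  moreover have "card (B1 \<union> B2) = n * \<rho> + card Q"
  proof -
    have card_C: "finite (C x)" "card (C x) = n" if "x < \<rho>" for x
      using card_rainbow_class[OF C, of x] that \<open>\<rho> \<le> n\<close> by auto
    have "card B1 = (\<Sum>x\<in>{0..<\<rho>}. card (ext x ` C x))"
      unfolding B1_def using card_C by (intro card_UN_disjoint) (auto simp: ext_inj)
    also have "\<dots> = (\<Sum>x\<in>{0..<\<rho>}. n)"
      using card_C by (intro sum.cong refl) (simp add: card_image inj_on_def ext_inj)
    finally have "card B1 = n * \<rho>" by simp
    moreover have "card B2 = card Q"
      unfolding B2_def by (intro card_image inj_onI) (simp add: inj_image_eq_iff)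
    moreover have "finite B1"
      unfolding B1_def using card_C by auto
    moreover have "Q \<subseteq> Pow {0..<\<rho> + 1}"
      using QB by blast
    then have "finite B2"
      unfolding B2_def by (simp add: finite_subset)
    moreover have "B1 \<inter> B2 = {}"
    proof -
      have False if b: "b \<in> B1" "b \<in> B2" for b
      proof -
        obtain x A where x: "x < \<rho>" "A \<in> C x" "b = ext x A"
          using B1_cases[OF b(1)] by blast
        have "A \<noteq> {}"
          using blk(2)[OF x(2,1)] by auto
        then obtain p where "p \<in> A" by blast
        then have "Inl p \<in> b" using x by (simp add: Inl_ext)
        then show False using b(2) unfolding B2_def by blast
      qed
      then show ?thesis by blast
    qed
    ultimately show ?thesis
      by (simp add: card_Un_disjoint)
  qed
  moreover have "largest_ppc_size (B1 \<union> B2) \<rho>"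
    unfolding largest_ppc_size_def
  proof (intro conjI)
    define P where "P = (\<lambda>x. ext x (fibre x)) ` {0..<\<rho>}"
    have "P \<subseteq> B1"
      unfolding P_def B1_def using rainbow_fibre[OF C] \<open>\<rho> \<le> n\<close> by force
    moreover have "b \<inter> c = {}" if "b \<in> P" "c \<in> P" "b \<noteq> c" for b c
      using that unfolding P_def ext_def by (auto simp: fibre_iff)
    ultimately have "is_ppc (B1 \<union> B2) P"
      unfolding is_ppc_def by blast
    moreover have "card P = \<rho>"
      unfolding P_def by (simp add: card_image inj_on_def ext_inj)
    ultimately show "\<exists>P. is_ppc (B1 \<union> B2) P \<and> card P = \<rho>"
      by blast
    have hit: "\<exists>x<\<rho>. Inr x \<in> b" if b: "b \<in> B1 \<union> B2" for b
    proof (cases "b \<in> B1")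
      case True
      then show ?thesis using B1_cases Inr_ext by blast
    next
      case False
      then obtain q where q: "q \<in> Q" "b = Inr ` q"
        using b unfolding B2_def by blast
      \<comment> \<open>A block of four points cannot consist of \<rho> alone, so it contains some x
        < \<rho>.\<close>
      have "\<not> q \<subseteq> {\<rho>}"
        using QB(2)[OF q(1)] card_mono[of "{\<rho>}" q] by auto
      then obtain x where "x \<in> q" "x \<noteq> \<rho>" by blast
      then have "x < \<rho>" using QB(1)[OF q(1)] by force
      then show ?thesis using \<open>x \<in> q\<close> q by blast
    qed
    show "\<nexists>P. is_ppc (B1 \<union> B2) P \<and> card P = \<rho> + 1"
    proof
      assume "\<exists>P. is_ppc (B1 \<union> B2) P \<and> card P = \<rho> + 1"
      then obtain P where ppc: "is_ppc (B1 \<union> B2) P" and card_P: "card P = \<rho> + 1"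
        by blast
      have disj: "b \<inter> c = {}" if "b \<in> P" "c \<in> P" "b \<noteq> c" for b c
        using ppc that by (simp add: is_ppc_def)
      have "\<exists>x. x < \<rho> \<and> Inr x \<in> b" if "b \<in> P" for b
        using hit[of b] ppc that by (auto simp: is_ppc_def)
      \<comment> \<open>Each block of the PPC is assigned one of the \<rho> adjoined points on it.
        Disjoint blocks receive different points, so at most \<rho> blocks are possible.\<close>
      then obtain h where h: "\<And>b. b \<in> P \<Longrightarrow> h b < \<rho> \<and> Inr (h b) \<in> b"
        by metis
      have "inj_on h P"
        using h disj by (intro inj_onI) (metis IntI empty_iff)
      then have "card P \<le> card {0..<\<rho>}"
        using h by (intro card_inj_on_le[of h]) auto
      then show False using card_P by simp
    qed
  qed
  ultimately show ?thesis
    by blast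
qed

theorem theorem2p9:
  fixes n \<rho> :: nat
  assumes "n \<ge> 4" and "n \<noteq> 6" and "1 \<le> \<rho>" and "\<rho> \<le> n"
  shows "\<exists>(X :: nat set) B. card X = 3 * n + 1 + \<rho> \<and> is_packing X B 4 \<and>
           card B = n * \<rho> + D (\<rho> + 1) 4 \<and> largest_ppc_size B \<rho>"
proof -
  obtain C where C: "rainbow_classes {0..<n} C"
    using rainbow_ge_4[OF assms(1)] unfolding rainbow_def by blast
  obtain Q where Q: "is_packing {0..<\<rho> + 1} Q 4" "card Q = D (\<rho> + 1) 4"
    using D_attained by blast
  obtain X :: "(nat \<times> int + nat) set" and B where X: "card X = 3 * n + 1 + \<rho>" "is_packing X B 4"
    "card B = n * \<rho> + D (\<rho> + 1) 4" "largest_ppc_size B \<rho>"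
    using packing_from_rainbow[OF C assms(4) Q(1)] unfolding Q(2) by blast
  have "finite X"
    using X(2) by (simp add: is_packing_def)
  then obtain f :: "nat \<times> int + nat \<Rightarrow> nat" where f: "inj_on f X"
    using finite_imp_inj_to_nat_seg by blast
  show ?thesis
  proof (intro exI conjI)
    show "card (f ` X) = 3 * n + 1 + \<rho>"
      using X(1) f by (simp add: card_image)
    show "is_packing (f ` X) ((`) f ` B) 4"
      by (rule packing_image(1)[OF X(2) f])
    show "card ((`) f ` B) = n * \<rho> + D (\<rho> + 1) 4"
      using packing_image(2)[OF X(2) f] X(3) by simp
    show "largest_ppc_size ((`) f ` B) \<rho>"
      by (rule packing_image(3)[OF X(2) f X(4)])
  qed
qed

end
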